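(* Let $A=\{a_1,\ldots,a_d\}$ with $a_1<a_2<\cdots<a_d$ positive integers. Then $$C_{123}(x,y,z)=\frac{1}{1-t^1(A)-\sum\limits_{p=3}^d\sum\limits_{j=0}^{p-3}\binom{p-3}{j}t^{p+j}(A)(y-1)^{p-2}},$$ where $t^p(A)=\sum_{1\leq i_1<i_2<\cdots<i_p\leq d}z^p\prod_{j=1}^p x^{a_{i_j}}$ (so $t^p(A)=0$ for $p>d$).
   Context: A composition of $n$ with parts in $A$ is a finite sequence $\sigma=\sigma_1\cdots\sigma_m$ ($m\ge0$) of elements of $A$ summing to $n$; $m$ is its number of parts (the empty composition is included). An occurrence of the pattern $123$ in $\sigma$ is an index $i$, $1\le i\le m-2$, with $\sigma_i<\sigma_{i+1}<\sigma_{i+2}$. $C_{123}(x,y,z)=\sum_\sigma x^{n(\sigma)}y^{r(\sigma)}z^{m(\sigma)}$, summing over all compositions $\sigma$ with parts in $A$, where $n(\sigma)$ is the sum of parts, $m(\sigma)$ the number of parts and $r(\sigma)$ the number of occurrences of $123$ in $\sigma$. *)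

theory Defs
  imports "HOL-Computational_Algebra.Formal_Power_Series"
begin

definition compositions :: "nat set \<Rightarrow> nat \<Rightarrow> nat list set" where
  "compositions A n = {\<sigma>. set \<sigma> \<subseteq> A \<and> sum_list \<sigma> = n}"

text \<open>Positions in lists are counted from 0.\<close>
definition occ_123 :: "nat list \<Rightarrow> nat" where
  "occ_123 \<sigma> = card {i. i + 2 < length \<sigma> \<and> \<sigma> ! i < \<sigma> ! (i + 1) \<and> \<sigma> ! (i + 1) < \<sigma> ! (i + 2)}"

text \<open>
  The ring of formal power series in \<open>x\<close>, \<open>y\<close>, \<open>z\<close> over the rationals is rendered as
  iterated univariate series, with \<open>x\<close> the outermost and \<open>y\<close> the innermost variable.
\<close>
type_synonym series_xzy = "rat fps fps fps"

definition var_x :: series_xzy where "var_x = fps_X"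
definition var_z :: series_xzy where "var_z = fps_const fps_X"
definition var_y :: series_xzy where "var_y = fps_const (fps_const fps_X)"

text \<open>
  The infinite sum over all compositions, grouped by the power of \<open>x\<close>: the inner sum is the
  coefficient of \<open>x^n\<close>, a series in the remaining variables \<open>z\<close> and \<open>y\<close>. It is a finite sum when
  all parts are positive.
\<close>
definition C_123 :: "nat set \<Rightarrow> series_xzy" where
  "C_123 A = Abs_fps (\<lambda>n. \<Sum>\<sigma>\<in>compositions A n.
      fps_const fps_X ^ occ_123 \<sigma> * fps_X ^ length \<sigma>)"

text \<open>\<open>t^p(A)\<close> for \<open>A = {a 1, \<dots>, a d}\<close>; the list \<open>is\<close> is the index tuple \<open>i\<^sub>1 < \<dots> < i\<^sub>p\<close>.\<close>
definition t_elem :: "(nat \<Rightarrow> nat) \<Rightarrow> nat \<Rightarrow> nat \<Rightarrow> series_xzy" where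
  "t_elem a d p = (\<Sum>is\<in>{is. length is = p \<and> set is \<subseteq> {1..d} \<and> sorted_wrt (<) is}.
      var_z ^ p * (\<Prod>j<p. var_x ^ a (is ! j)))"

lemma finite_compositions:
  assumes "0 \<notin> A"
  shows "finite (compositions A n)"
proof (rule finite_subset)
  have len: "length \<sigma> \<le> sum_list \<sigma>" if "set \<sigma> \<subseteq> A" for \<sigma>
    using that
  proof (induction \<sigma>)
    case (Cons b \<sigma>)
    then have "0 < b" using assms by (cases b) auto
    with Cons show ?case by simp
  qed simp
  show "compositions A n \<subseteq> {\<sigma>. set \<sigma> \<subseteq> {..n} \<and> length \<sigma> \<le> n}"
    using len by (auto simp: compositions_def member_le_sum_list)
  show "finite {\<sigma>. set \<sigma> \<subseteq> {..n} \<and> length \<sigma> \<le> n}"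
    by (rule finite_lists_length_le) simp
qed

lemma C_123_coeff:
  assumes "0 \<notin> A"
  shows "fps_nth (fps_nth (fps_nth (C_123 A) n) m) r =
    of_nat (card {\<sigma> \<in> compositions A n. length \<sigma> = m \<and> occ_123 \<sigma> = r})"
proof -
  have "fps_nth (fps_nth (fps_nth (C_123 A) n) m) r =
      (\<Sum>\<sigma>\<in>compositions A n. if length \<sigma> = m \<and> occ_123 \<sigma> = r then 1 else 0)"
    unfolding C_123_def
    by (simp add: fps_sum_nth, intro sum.cong) (auto simp: fps_X_power_iff)
  also have "\<dots> = of_nat (card {\<sigma> \<in> compositions A n. length \<sigma> = m \<and> occ_123 \<sigma> = r})"
    by (simp add: sum.If_cases finite_compositions[OF assms] Int_def)
  finally show ?thesis .
qed

text \<open>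
  Here the coefficients of the outermost series do not form a field, so \<open>/\<close> need not be a quotient
  in general; it is one whenever the denominator has constant term 1 with respect to \<open>x\<close>.
\<close>
lemma divide_by_unit_series:
  fixes D :: series_xzy
  assumes "fps_nth D 0 = 1"
  shows "(1 / D) * D = 1"
proof -
  have "inverse (1 :: rat fps fps) = 1"
    by (rule fps_inverse_one') (simp add: fps_inverse_one')
  then have "D * inverse D = 1"
    using fps_right_inverse[of D 1] assms by (simp add: fps_inverse_def)
  moreover have "1 / D = inverse D"
    using assms by (simp add: fps_divide_unit)
  ultimately show ?thesis by (simp add: mult.commute)
qed

end

theory Submission
  imports Defs
begin

text \<open>
  Put \<open>w = y - 1\<close> and let \<open>c\<^sub>0 = -1\<close>, \<open>c\<^sub>1 = 1\<close>, \<open>c\<^sub>L\<^sub>+\<^sub>2 = w (c\<^sub>L\<^sub>+\<^sub>1 + c\<^sub>L)\<close>. For \<open>L \<ge> 3\<close> this is the generating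
  function, in the sense of the Goulden-Jackson cluster method, of the ways to cover an increasing
  word of length \<open>L\<close> by overlapping marked occurrences of \<open>123\<close>. Instead of using inclusion-exclusion
  one can verify directly, by induction on a nonempty word \<open>\<sigma>\<close>, that \<open>c\<^sub>L y\<^bsup>r(\<sigma>')\<^esup>\<close> sums to 0 over all
  factorisations \<open>\<sigma> = u \<sigma>'\<close> with \<open>u\<close> strictly increasing of length \<open>L\<close>. Summing this over all
  compositions gives \<open>(\<Sum>\<^sub>L c\<^sub>L t\<^sup>L(A)) C = -1\<close>, and \<open>c\<^sub>L\<close> has a closed form of Fibonacci type.
\<close>

section \<open>Cluster weights and their closed form\<close>

fun cluster_poly :: "'a::comm_ring_1 \<Rightarrow> nat \<Rightarrow> 'a" where
  "cluster_poly w 0 = - 1"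
| "cluster_poly w (Suc 0) = 1"
| "cluster_poly w (Suc (Suc n)) = w * (cluster_poly w (Suc n) + cluster_poly w n)"

text \<open>Pascal's rule, applied to each coefficient after the vanishing \<open>q = 0\<close> term
  is dropped and \<open>q\<close> is shifted by one.\<close>

lemma fib_poly_rec:
  fixes w :: "'a::comm_ring_1"
  defines "F \<equiv> \<lambda>m. \<Sum>q\<le>m. of_nat (q choose (m - q)) * w ^ q"
  shows "F (Suc (Suc m)) = w * (F (Suc m) + F m)"
proof -
  have "F (Suc (Suc m)) = (\<Sum>q\<le>Suc m. of_nat (Suc q choose (Suc m - q)) * w ^ Suc q)"
    unfolding F_def by (subst sum.atMost_Suc_shift) simp
  \<comment> \<open>The term \<open>q = Suc m\<close> is split off because its lower binomial index
    is 0, where Pascal's rule does not apply.\<close>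
  also have "\<dots> = (\<Sum>q\<le>m. of_nat (Suc q choose Suc (m - q)) * w ^ Suc q) + w ^ Suc (Suc m)"
    by (simp add: Suc_diff_le)
  also have "\<dots> = w * ((\<Sum>q\<le>m. of_nat (q choose Suc (m - q)) * w ^ q) + w ^ Suc m + F m)"
    by (simp add: F_def sum_distrib_left sum.distrib algebra_simps)
  also have "(\<Sum>q\<le>m. of_nat (q choose Suc (m - q)) * w ^ q) + w ^ Suc m = F (Suc m)"
    by (simp add: F_def Suc_diff_le)
  finally show ?thesis .
qed

text \<open>Here \<open>q + 1\<close> counts marked occurrences. Each one after the first starts 1
  or 2 places after its predecessor, and a total length of \<open>m + 3\<close> forces exactly
  \<open>m - q\<close> of these \<open>q\<close> shifts to be 2.\<close>

lemma cluster_poly_eq_sum: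
  "cluster_poly w (m + 3) = (\<Sum>q\<le>m. of_nat (q choose (m - q)) * w ^ (q + 1))"
proof -
  have "cluster_poly w (m + 3) = w * (\<Sum>q\<le>m. of_nat (q choose (m - q)) * w ^ q)"
  proof (induction m rule: induct_nat_012)
    case 0
    then show ?case by (simp add: numeral_3_eq_3)
  next
    case 1
    then show ?case by (simp add: numeral_3_eq_3)
  next
    case (ge2 m)
    then show ?case
      by (simp only: fib_poly_rec) (simp add: numeral_3_eq_3 algebra_simps)
  qed
  then show ?thesis by (simp add: sum_distrib_left mult_ac)
qed

section \<open>Cancellation over the increasing prefixes of a word\<close>

lemma occ_123_short: "length \<sigma> \<le> 2 \<Longrightarrow> occ_123 \<sigma> = 0"
  by (auto simp: occ_123_def)

lemma occ_123_Cons3: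
  "occ_123 (a # b # c # \<sigma>) = (if a < b \<and> b < c then 1 else 0) + occ_123 (b # c # \<sigma>)"
proof -
  let ?P = "\<lambda>\<tau> i. i + 2 < length \<tau> \<and> \<tau> ! i < \<tau> ! (i + 1) \<and> \<tau> ! (i + 1) < \<tau> ! (i + 2)"
  have fin: "finite {i. ?P \<tau> i}" for \<tau> :: "nat list"
    by (rule finite_subset[of _ "{..<length \<tau>}"]) auto
  have "{i. ?P (a # b # c # \<sigma>) i} =
      (if a < b \<and> b < c then {0} else {}) \<union> Suc ` {i. ?P (b # c # \<sigma>) i}"
    (is "?l = ?r")
  proof (rule set_eqI)
    fix i show "i \<in> ?l \<longleftrightarrow> i \<in> ?r" by (cases i) auto
  qed
  then show ?thesis
    unfolding occ_123_def using fin[of "b # c # \<sigma>"]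
    by (simp add: card_insert_if card_image)
qed

definition incr_prefix_sum :: "'a::comm_ring_1 \<Rightarrow> nat list \<Rightarrow> 'a" where
  "incr_prefix_sum y \<sigma> = (\<Sum>L\<le>length \<sigma>. if sorted_wrt (<) (take L \<sigma>)
     then cluster_poly (y - 1) L * y ^ occ_123 (drop L \<sigma>) else 0)"

lemma incr_prefix_sum_Nil: "incr_prefix_sum y [] = - 1"
  by (simp add: incr_prefix_sum_def occ_123_short)

lemma incr_prefix_sum_Cons:
  "incr_prefix_sum y (b # \<sigma>) = - (y ^ occ_123 (b # \<sigma>)) +
     (\<Sum>L\<le>length \<sigma>. if sorted_wrt (<) (b # take L \<sigma>)
       then cluster_poly (y - 1) (Suc L) * y ^ occ_123 (drop L \<sigma>) else 0)"
  unfolding incr_prefix_sum_def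
  by (simp add: sum.atMost_Suc_shift del: sum.atMost_Suc sorted_wrt.simps(2) cong: if_cong)

lemma sorted_wrt_less_Cons2:
  fixes a b :: "'a::preorder"
  shows "sorted_wrt (<) (a # b # \<sigma>) \<longleftrightarrow> a < b \<and> sorted_wrt (<) (b # \<sigma>)"
  by (auto intro: less_trans)

text \<open>The prefixes of length 0 and 1, with weights -1 and 1, are split off. Since
  \<open>a < b\<close>, the condition on the other prefixes no longer involves \<open>a\<close>, so
  their sum is that of \<open>b # \<sigma>\<close> in \<open>incr_prefix_sum_Cons\<close> with the
  cluster index raised by one.\<close>

lemma incr_prefix_sum_Cons2:
  assumes "a < b"
  shows "incr_prefix_sum y (a # b # \<sigma>) = - (y ^ occ_123 (a # b # \<sigma>)) + y ^ occ_123 (b # \<sigma>) +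
     (\<Sum>L\<le>length \<sigma>. if sorted_wrt (<) (b # take L \<sigma>)
       then cluster_poly (y - 1) (Suc (Suc L)) * y ^ occ_123 (drop L \<sigma>) else 0)"
  using assms
  by (simp add: incr_prefix_sum_Cons[of y a] sum.atMost_Suc_shift sorted_wrt_less_Cons2
      del: sum.atMost_Suc sorted_wrt.simps(2) cluster_poly.simps(3) cong: if_cong)
    (simp del: cluster_poly.simps(3) cong: if_cong)

text \<open>Any prefix reaching beyond \<open>b\<close> contains the failed ascent from
  \<open>b\<close> to \<open>hd \<sigma>\<close>, so only \<open>L = 0\<close> survives.\<close>

lemma incr_prefix_sum_Cons_no_ascent:
  assumes "\<sigma> = [] \<or> \<not> b < hd \<sigma>"
  shows "(\<Sum>L\<le>length \<sigma>. if sorted_wrt (<) (b # take L \<sigma>) then f L else 0) =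
    (f 0 :: 'a::comm_monoid_add)"
proof (cases \<sigma>)
  case Nil
  then show ?thesis by simp
next
  case (Cons c \<tau>)
  with assms show ?thesis
    by (simp add: sum.atMost_Suc_shift sorted_wrt_less_Cons2
        del: sum.atMost_Suc sorted_wrt.simps(2)) simp
qed

text \<open>If one of the first two steps is not an ascent, the first letter starts no occurrence
  and the prefixes of length 0 and 1 cancel. If both are ascents, the recursion for the weights
  reduces the remaining sum to the two next shorter suffixes.\<close>

lemma incr_prefix_sum_eq_0: "\<sigma> \<noteq> [] \<Longrightarrow> incr_prefix_sum y \<sigma> = 0"
proof (induction \<sigma> rule: length_induct)
  case (1 \<sigma>)
  then obtain a \<tau> where \<sigma>: "\<sigma> = a # \<tau>" by (cases \<sigma>) auto
  show ?case
  proof (cases "\<tau> = [] \<or> \<not> a < hd \<tau>")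
    case True
    then have "occ_123 (a # \<tau>) = occ_123 \<tau>"
      by (cases \<tau>; cases "tl \<tau>") (auto simp: occ_123_short occ_123_Cons3)
    then show ?thesis
      unfolding \<sigma> incr_prefix_sum_Cons incr_prefix_sum_Cons_no_ascent[OF True] by simp
  next
    case False
    then obtain b \<rho> where \<tau>: "\<tau> = b # \<rho>" and ab: "a < b" by (cases \<tau>) auto
    have IH: "incr_prefix_sum y (b # \<rho>) = 0" using 1 by (simp add: \<sigma> \<tau>)
    show ?thesis
    proof (cases "\<rho> = [] \<or> \<not> b < hd \<rho>")
      case True
      then have "occ_123 (a # b # \<rho>) = occ_123 (b # \<rho>)"
        by (cases \<rho>) (auto simp: occ_123_short occ_123_Cons3)
      \<comment> \<open>The only further increasing prefix has length 2, and its weight is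
        \<open>(y - 1) * (1 + (- 1)) = 0\<close>.\<close>
      then show ?thesis
        unfolding \<sigma> \<tau> incr_prefix_sum_Cons2[OF ab] incr_prefix_sum_Cons_no_ascent[OF True]
        by simp
    next
      case False
      then obtain c \<kappa> where \<rho>: "\<rho> = c # \<kappa>" and bc: "b < c" by (cases \<rho>) auto
      have IH2: "incr_prefix_sum y \<rho> = 0" using 1 by (simp add: \<sigma> \<tau> \<rho>)
      \<comment> \<open>Prepending \<open>b\<close> does not affect sortedness, so the sums for all
        three suffixes run over the same \<open>L\<close> and differ only in the weight
        index.\<close>
      have sorted: "sorted_wrt (<) (b # take L \<rho>) \<longleftrightarrow> sorted_wrt (<) (take L \<rho>)" for L
        using bc by (cases L) (auto simp: \<rho>)
      let ?f = "\<lambda>k. \<Sum>L\<le>length \<rho>. if sorted_wrt (<) (take L \<rho>)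
          then cluster_poly (y - 1) (k L) * y ^ occ_123 (drop L \<rho>) else 0"
      have "?f (\<lambda>L. Suc (Suc L)) = (y - 1) * (?f Suc + ?f (\<lambda>L. L))"
        by (simp add: sum_distrib_left sum.distrib[symmetric] algebra_simps if_distrib
            cong: if_cong sum.cong)
      also have "?f (\<lambda>L. L) = 0" using IH2 by (simp add: incr_prefix_sum_def)
      also have "?f Suc = y ^ occ_123 (b # \<rho>)"
        using IH unfolding incr_prefix_sum_Cons sorted by simp
      \<comment> \<open>With \<open>r = occ_123 (b # \<rho>)\<close>, the total is
        \<open>- y ^ (r + 1) + y ^ r + (y - 1) * y ^ r = 0\<close>.\<close>
      finally show ?thesis
        unfolding \<sigma> \<tau> incr_prefix_sum_Cons2[OF ab] sorted
        using ab bc by (simp add: \<rho> occ_123_Cons3 algebra_simps)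
    qed
  qed
qed

section \<open>The product identity for the generating series\<close>

definition incr_lists :: "nat set \<Rightarrow> nat list set" where
  "incr_lists A = {u. set u \<subseteq> A \<and> sorted_wrt (<) u}"

lemma length_incr_list:
  assumes "finite A" "u \<in> incr_lists A"
  shows "length u \<le> card A"
proof -
  have "distinct u" using assms by (simp add: incr_lists_def strict_sorted_iff)
  then have "length u = card (set u)" by (simp add: distinct_card)
  then show ?thesis using assms by (simp add: incr_lists_def card_mono)
qed

lemma finite_incr_lists:
  assumes "finite A"
  shows "finite (incr_lists A)"
proof (rule finite_subset)
  show "incr_lists A \<subseteq> {u. set u \<subseteq> A \<and> length u \<le> card A}"
    using length_incr_list[OF assms] by (auto simp: incr_lists_def)
  show "finite {u. set u \<subseteq> A \<and> length u \<le> card A}"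
    by (rule finite_lists_length_le[OF assms])
qed

abbreviation comp_y :: "rat fps fps" where
  "comp_y \<equiv> fps_const fps_X"

text \<open>The coefficient of \<open>x^n\<close> runs over pairs of an increasing word and a
  composition with total sum \<open>n\<close>. Grouping the pairs by their concatenation yields
  \<open>incr_prefix_sum\<close>, which vanishes except on the empty word.\<close>

lemma incr_lists_series_mult_C_123:
  assumes "finite A" "0 \<notin> A"
  shows "(\<Sum>u\<in>incr_lists A. fps_const (cluster_poly (comp_y - 1) (length u) * fps_X ^ length u) *
           fps_X ^ sum_list u) * C_123 A = - 1"
proof (rule fps_ext)
  fix n
  let ?c = "cluster_poly (comp_y - 1)"
  let ?g = "\<lambda>(u, v). ?c (length u) * fps_X ^ length u *
      (comp_y ^ occ_123 v * fps_X ^ length v)"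
  let ?U = "{u \<in> incr_lists A. sum_list u \<le> n}"
  have "fps_nth ((\<Sum>u\<in>incr_lists A. fps_const (?c (length u) * fps_X ^ length u) *
      fps_X ^ sum_list u) * C_123 A) n =
    (\<Sum>u\<in>incr_lists A. if sum_list u \<le> n then ?c (length u) * fps_X ^ length u *
       fps_nth (C_123 A) (n - sum_list u) else 0)"
    by (simp add: sum_distrib_right fps_sum_nth mult.assoc fps_X_power_mult_nth
        if_distrib not_less cong: if_cong) (auto intro!: sum.cong)
  also have "\<dots> = (\<Sum>u\<in>?U. ?c (length u) * fps_X ^ length u * fps_nth (C_123 A) (n - sum_list u))"
    using finite_incr_lists[OF assms(1)] by (simp add: sum.inter_filter)
  also have "\<dots> = (\<Sum>u\<in>?U. \<Sum>v\<in>compositions A (n - sum_list u). ?g (u, v))"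
    by (simp add: C_123_def sum_distrib_left)
  also have "\<dots> = (\<Sum>uv\<in>(SIGMA u:?U. compositions A (n - sum_list u)). ?g uv)"
    using finite_incr_lists[OF assms(1)] finite_compositions[OF assms(2)]
    by (subst sum.Sigma) auto
  \<comment> \<open>A pair \<open>(u, v)\<close> corresponds to the word \<open>u @ v\<close>
    together with the cut position \<open>length u\<close>.\<close>
  also have "\<dots> = (\<Sum>(\<sigma>, L)\<in>(SIGMA \<sigma>:compositions A n.
      {L \<in> {..length \<sigma>}. sorted_wrt (<) (take L \<sigma>)}).
      fps_X ^ length \<sigma> * (?c L * comp_y ^ occ_123 (drop L \<sigma>)))"
  proof (rule sum.reindex_bij_witness[of _ "\<lambda>(\<sigma>, L). (take L \<sigma>, drop L \<sigma>)"
        "\<lambda>(u, v). (u @ v, length u)"], goal_cases)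
    case (4 b)
    obtain \<sigma> L where b: "b = (\<sigma>, L)" by (cases b)
    have "sum_list (take L \<sigma>) + sum_list (drop L \<sigma>) = sum_list \<sigma>"
      by (metis append_take_drop_id sum_list_append)
    moreover have "set (take L \<sigma>) \<subseteq> set \<sigma>" "set (drop L \<sigma>) \<subseteq> set \<sigma>"
      by (rule set_take_subset set_drop_subset)+
    ultimately show ?case using 4
      by (auto simp: b incr_lists_def compositions_def)
  qed (auto simp: incr_lists_def compositions_def power_add mult_ac)
  also have "\<dots> = (\<Sum>\<sigma>\<in>compositions A n. \<Sum>L\<in>{L \<in> {..length \<sigma>}. sorted_wrt (<) (take L \<sigma>)}.
      fps_X ^ length \<sigma> * (?c L * comp_y ^ occ_123 (drop L \<sigma>)))"
    using finite_compositions[OF assms(2)] by (subst sum.Sigma) auto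
  also have "\<dots> = (\<Sum>\<sigma>\<in>compositions A n. fps_X ^ length \<sigma> * incr_prefix_sum comp_y \<sigma>)"
    unfolding incr_prefix_sum_def
    by (subst sum.inter_filter[symmetric]) (simp_all add: sum_distrib_left)
  also have "\<dots> = (\<Sum>\<sigma>\<in>compositions A n. if \<sigma> = [] then - 1 else 0)"
    by (intro sum.cong) (auto simp: incr_prefix_sum_Nil incr_prefix_sum_eq_0)
  also have "\<dots> = (if n = 0 then - 1 else 0)"
    using finite_compositions[OF assms(2)] by (auto simp: sum.delta compositions_def)
  finally show "fps_nth ((\<Sum>u\<in>incr_lists A. fps_const (?c (length u) * fps_X ^ length u) *
      fps_X ^ sum_list u) * C_123 A) n = fps_nth (- 1) n" by simp
qed

section \<open>The series \<open>t_elem\<close> and the shape of the denominator\<close>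

lemma t_elem_eq_sum_incr_lists:
  assumes "strict_mono_on {1..d} a" "A = a ` {1..d}"
  shows "t_elem a d p =
    (\<Sum>u\<in>{u \<in> incr_lists A. length u = p}. fps_const (fps_X ^ length u) * fps_X ^ sum_list u)"
proof -
  let ?I = "{is. length is = p \<and> set is \<subseteq> {1..d} \<and> sorted_wrt (<) is}"
  have inj: "inj_on a {1..d}" using assms(1) by (rule strict_mono_on_imp_inj_on)
  have less: "a i < a j \<longleftrightarrow> i < j" if "i \<in> {1..d}" "j \<in> {1..d}" for i j
    using assms(1) that by (rule strict_mono_on_less)
  \<comment> \<open>Strict monotonicity of \<open>a\<close> on the indices lets \<open>map a\<close>
    turn increasing index tuples into increasing words and back.\<close>
  have sorted: "sorted_wrt (<) (map a is) \<longleftrightarrow> sorted_wrt (<) is" if "set is \<subseteq> {1..d}" for "is"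
    unfolding sorted_wrt_map using that by (induction "is") (auto simp: less subset_iff)
  have "t_elem a d p = (\<Sum>is\<in>?I. fps_const (fps_X ^ length (map a is)) * fps_X ^ sum_list (map a is))"
    unfolding t_elem_def var_x_def var_z_def
    by (intro sum.cong)
      (auto simp: sum_list_sum_nth atLeast0LessThan power_sum fps_const_power)
  also have "\<dots> = (\<Sum>u\<in>map a ` ?I. fps_const (fps_X ^ length u) * fps_X ^ sum_list u)"
  proof (subst sum.reindex)
    show "inj_on (map a) ?I" by (rule inj_on_mapI, rule inj_on_subset[OF inj]) auto
  qed simp
  also have "map a ` ?I = {u \<in> incr_lists A. length u = p}"
  proof safe
    fix u assume u: "u \<in> incr_lists A" "p = length u"
    then have "u \<in> map a ` lists {1..d}"
      by (auto simp: incr_lists_def assms(2) simp flip: lists_image)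
    then obtain "is" where "u = map a is" "set is \<subseteq> {1..d}" by auto
    with u sorted[of "is"] show "u \<in> map a ` {is. length is = length u \<and> set is \<subseteq> {1..d} \<and> sorted_wrt (<) is}"
      by (auto simp: incr_lists_def)
  next
    fix "is" assume "set is \<subseteq> {1..d}" "sorted_wrt (<) is"
    with sorted[of "is"] assms(2) show "map a is \<in> incr_lists A"
      by (auto simp: incr_lists_def)
  qed simp
  finally show ?thesis .
qed

lemma t_elem_eq_0:
  assumes "d < p"
  shows "t_elem a d p = 0"
proof -
  have "length is \<le> d" if "set is \<subseteq> {1..d}" "sorted_wrt (<) is" for "is" :: "nat list"
    using length_incr_list[of "{1..d}" "is"] that by (simp add: incr_lists_def)
  then have "{is. length is = p \<and> set is \<subseteq> {1..d} \<and> sorted_wrt (<) is} = {}"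
    using assms by fastforce
  then show ?thesis unfolding t_elem_def by (simp only: sum.empty)
qed

lemma t_elem_0: "t_elem a d 0 = 1"
proof -
  have "{is. length is = 0 \<and> set is \<subseteq> {1..d} \<and> sorted_wrt (<) is} = {[] :: nat list}" by auto
  then show ?thesis by (simp add: t_elem_def)
qed

text \<open>The substitution \<open>L = p + j\<close>, \<open>q = p - 3\<close> matches the double
  sum with the closed form of the weights: the binomial becomes \<open>q choose (L - 3 - q)\<close>
  and the exponent \<open>p - 2\<close> becomes \<open>q + 1\<close>.\<close>

lemma sum_cluster_poly_t_elem:
  "(\<Sum>L\<le>d. cluster_poly w L * t_elem a d L) = - 1 + t_elem a d 1 +
     (\<Sum>p=3..d. \<Sum>j=0..p-3. of_nat ((p - 3) choose j) * t_elem a d (p + j) * w ^ (p - 2))"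
proof -
  define g where "g p j = of_nat ((p - 3) choose j) * t_elem a d (p + j) * w ^ (p - 2)" for p j
  \<comment> \<open>Both bounds on \<open>j\<close> can be relaxed to \<open>d\<close>: the binomial
    vanishes for \<open>j > p - 3\<close> and \<open>t_elem\<close> for \<open>p + j > d\<close>.
    The second bound describes the triangle \<open>p + j \<le> d\<close>, which suits summation by
    \<open>L\<close>.\<close>
  have "(\<Sum>p=3..d. \<Sum>j=0..p-3. g p j) = (\<Sum>p=3..d. \<Sum>j=0..d-p. g p j)"
  proof (rule sum.cong)
    fix p assume p: "p \<in> {3..d}"
    have "(\<Sum>j=0..p-3. g p j) = (\<Sum>j=0..d. g p j)"
      using p by (intro sum.mono_neutral_left) (auto simp: g_def)
    also have "\<dots> = (\<Sum>j=0..d-p. g p j)"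
      using p by (intro sum.mono_neutral_right) (auto simp: g_def t_elem_eq_0)
    finally show "(\<Sum>j=0..p-3. g p j) = (\<Sum>j=0..d-p. g p j)" .
  qed simp
  also have "\<dots> = (\<Sum>(p, j)\<in>(SIGMA p:{3..d}. {0..d-p}). g p j)"
    by (subst sum.Sigma) auto
  also have "\<dots> = (\<Sum>(L, q)\<in>(SIGMA L:{3..d}. {..L-3}). g (q + 3) (L - 3 - q))"
    by (rule sum.reindex_bij_witness[of _ "\<lambda>(L, q). (q + 3, L - 3 - q)" "\<lambda>(p, j). (p + j, p - 3)"])
      auto
  also have "\<dots> = (\<Sum>L=3..d. \<Sum>q\<le>L-3. g (q + 3) (L - 3 - q))"
    by (subst sum.Sigma) auto
  also have "\<dots> = (\<Sum>L=3..d. cluster_poly w L * t_elem a d L)"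
  proof (rule sum.cong)
    fix L assume "L \<in> {3..d}"
    then obtain m where L: "L = m + 3" by (metis atLeastAtMost_iff le_Suc_ex add.commute)
    show "(\<Sum>q\<le>L-3. g (q + 3) (L - 3 - q)) = cluster_poly w L * t_elem a d L"
      unfolding L cluster_poly_eq_sum sum_distrib_right
      by (intro sum.cong) (auto simp: g_def mult_ac add_ac)
  qed simp
  finally have *: "(\<Sum>p=3..d. \<Sum>j=0..p-3. g p j) = (\<Sum>L=3..d. cluster_poly w L * t_elem a d L)" .
  \<comment> \<open>For \<open>d < 2\<close> the right-hand index set is larger, but
    \<open>t_elem\<close> is 0 at the extra indices. The weights at 0, 1, 2 are -1, 1, 0.\<close>
  have "(\<Sum>L\<le>d. cluster_poly w L * t_elem a d L) =
      (\<Sum>L\<in>{0, 1, 2} \<union> {3..d}. cluster_poly w L * t_elem a d L)"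
    by (rule sum.mono_neutral_left) (auto simp: t_elem_eq_0)
  also have "\<dots> = - 1 + t_elem a d 1 + (\<Sum>L=3..d. cluster_poly w L * t_elem a d L)"
    by (subst sum.union_disjoint) (auto simp: t_elem_0 numeral_2_eq_2)
  finally show ?thesis using * by (simp add: g_def)
qed

text \<open>The weights are integer polynomials in \<open>w\<close>, so they commute with the ring
  homomorphism \<open>fps_const\<close>. This moves them from series in \<open>z\<close> and
  \<open>y\<close> to series in \<open>x\<close>.\<close>

lemma fps_const_cluster_poly: "fps_const (cluster_poly w n) = cluster_poly (fps_const w) n"
  by (induction w n rule: cluster_poly.induct)
    (simp_all flip: fps_const_mult fps_const_add fps_const_neg)

theorem theorem3:
  fixes a :: "nat \<Rightarrow> nat" and d :: nat and A :: "nat set"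
  assumes "strict_mono_on {1..d} a"
    and "\<And>i. i \<in> {1..d} \<Longrightarrow> 0 < a i"
    and "A = a ` {1..d}"
  shows "C_123 A =
    1 / (1 - t_elem a d 1
           - (\<Sum>p=3..d. \<Sum>j=0..p-3.
                of_nat ((p - 3) choose j) * t_elem a d (p + j) * (var_y - 1) ^ (p - 2)))"
proof -
  let ?c = "cluster_poly (comp_y - 1)"
  define D where "D = 1 - t_elem a d 1
           - (\<Sum>p=3..d. \<Sum>j=0..p-3.
                of_nat ((p - 3) choose j) * t_elem a d (p + j) * (var_y - 1) ^ (p - 2))"
  have fin: "finite A" and pos: "0 \<notin> A" and card: "card A \<le> d"
    using assms card_image_le[of "{1..d}" a] by fastforce+
  have w: "var_y - 1 = fps_const (comp_y - 1)"
    by (simp add: var_y_def flip: fps_const_sub)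
  have "- D = (\<Sum>p\<le>d. fps_const (?c p) * t_elem a d p)"
    using sum_cluster_poly_t_elem[of "var_y - 1" a d]
    by (simp add: D_def w fps_const_cluster_poly)
  also have "\<dots> = (\<Sum>p\<le>d. \<Sum>u\<in>{u \<in> incr_lists A. length u = p}.
      fps_const (?c (length u) * fps_X ^ length u) * fps_X ^ sum_list u)"
    by (auto simp: t_elem_eq_sum_incr_lists[OF assms(1,3)] sum_distrib_left mult.assoc
        simp flip: fps_const_mult intro!: sum.cong)
  \<comment> \<open>Regrouping by length loses no word, since an increasing word over
    \<open>A\<close> has length at most \<open>card A \<le> d\<close>.\<close>
  also have "\<dots> = (\<Sum>u\<in>incr_lists A.
      fps_const (?c (length u) * fps_X ^ length u) * fps_X ^ sum_list u)"
    using length_incr_list[OF fin] card finite_incr_lists[OF fin]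
    by (intro sum.group) (auto intro: le_trans)
  finally have "- D * C_123 A = - 1"
    using incr_lists_series_mult_C_123[OF fin pos] by simp
  then have DC: "D * C_123 A = 1" by simp
  \<comment> \<open>Division by \<open>D\<close> requires its constant term in \<open>x\<close> to
    be 1. This is read off from \<open>D * C_123 A = 1\<close>, because the empty composition alone
    gives \<open>C_123 A\<close> the constant term 1.\<close>
  have "compositions A 0 = {[]}"
    using pos by (auto simp: compositions_def) (metis list.set_intros(1) neq_Nil_conv subsetD)
  then have "fps_nth (C_123 A) 0 = 1" by (simp add: C_123_def occ_123_short)
  with arg_cong[OF DC, of "\<lambda>f. fps_nth f 0"] have "fps_nth D 0 = 1" by simp
  then have "(1 / D) * D = 1" by (rule divide_by_unit_series)
  then have "C_123 A = (1 / D) * (D * C_123 A)" by (simp only: mult.assoc[symmetric] mult_1)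
  then have "C_123 A = 1 / D" by (simp only: DC mult_1_right)
  then show ?thesis by (simp only: D_def)
qed

end
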